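(* Let $\xi=(\tau_L,\delta_L,\tau_R,\delta_R)\in\mathbb{R}^4$, let $P\in\mathbb{R}^2$ and $v\in\mathbb{R}^2$, and let $\alpha$ be the line segment from $P$ to $Q=P+v$, with length $|\alpha|=\|v\|$. Let $s$ be the length of the longest line segment contained in $f_\xi(\alpha)$ and let $c_L,c_R>0$. If $\|A_Lv\|\ge c_L\|v\|$ and $\|A_Rv\|\ge c_R\|v\|$, then $s\ge\frac{c_Lc_R}{c_L+c_R}\,|\alpha|$.
   Context: For $\xi=(\tau_L,\delta_L,\tau_R,\delta_R)\in\mathbb{R}^4$ define $f_\xi:\mathbb{R}^2\to\mathbb{R}^2$ by $f_\xi(x,y)=(\tau_L x+y+1,\,-\delta_L x)$ if $x\le 0$ and $f_\xi(x,y)=(\tau_R x+y+1,\,-\delta_R x)$ if $x\ge 0$, and let $A_L=\begin{bmatrix}\tau_L&1\\-\delta_L&0\end{bmatrix}$, $A_R=\begin{bmatrix}\tau_R&1\\-\delta_R&0\end{bmatrix}$. $\|\cdot\|$ is the Euclidean norm; the length of a line segment is the distance between its endpoints. *)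

theory Defs
  imports "HOL-Analysis.Analysis"
begin

text \<open>Border-collision normal form; parameter xi = (tauL, deltaL, tauR, deltaR).\<close>
definition bcnf :: "real \<times> real \<times> real \<times> real \<Rightarrow> real^2 \<Rightarrow> real^2" where
  "bcnf xi p = (case xi of (tL, dL, tR, dR) \<Rightarrow>
     (if p$1 \<le> 0 then vector [tL * p$1 + p$2 + 1, - dL * p$1]
      else vector [tR * p$1 + p$2 + 1, - dR * p$1]))"

definition AL :: "real \<times> real \<times> real \<times> real \<Rightarrow> real^2^2" where
  "AL xi = (case xi of (tL, dL, tR, dR) \<Rightarrow> vector [vector [tL, 1], vector [- dL, 0]])"

definition AR :: "real \<times> real \<times> real \<times> real \<Rightarrow> real^2^2" where
  "AR xi = (case xi of (tL, dL, tR, dR) \<Rightarrow> vector [vector [tR, 1], vector [- dR, 0]])"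

text \<open>Length of the longest line segment contained in a set S.\<close>
definition longest_segment_length :: "(real^2) set \<Rightarrow> real" where
  "longest_segment_length S = Sup {dist a b | a b. closed_segment a b \<subseteq> S}"

end

theory Submission
  imports Defs
begin

text \<open>On each closed half-plane \<open>x \<le> 0\<close>, \<open>x \<ge> 0\<close> the map \<open>f\<^sub>\<xi>\<close> is affine with linear
  part \<open>A\<^sub>L\<close> resp. \<open>A\<^sub>R\<close>, so every subsegment of \<open>\<alpha>\<close> lying in one half-plane is mapped onto a
  segment contained in \<open>f\<^sub>\<xi>(\<alpha>)\<close>. If \<open>\<alpha>\<close> crosses the switching line at \<open>P + t v\<close>, the two
  pieces give \<open>s \<ge> t c\<^sub>L |\<alpha>|\<close> and \<open>s \<ge> (1 - t) c\<^sub>R |\<alpha>|\<close>; averaging these with weights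
  \<open>c\<^sub>R/(c\<^sub>L + c\<^sub>R)\<close> and \<open>c\<^sub>L/(c\<^sub>L + c\<^sub>R)\<close> eliminates \<open>t\<close>. If \<open>\<alpha>\<close> lies in one half-plane,
  its whole image is a segment of length at least \<open>c\<^sub>L |\<alpha>|\<close> or \<open>c\<^sub>R |\<alpha>|\<close>.\<close>

lemma affine_image_closed_segment:
  fixes g :: "'a::real_vector \<Rightarrow> 'b::real_vector"
  assumes "linear g" and "\<And>x. x \<in> closed_segment a b \<Longrightarrow> f x = c + g x"
  shows "f ` closed_segment a b = closed_segment (f a) (f b)"
proof -
  have "f ` closed_segment a b = (\<lambda>x. c + x) ` g ` closed_segment a b"
    using assms(2) by (simp add: image_image cong: image_cong)
  also have "\<dots> = closed_segment (c + g a) (c + g b)"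
    by (simp add: closed_segment_linear_image[OF assms(1)] closed_segment_translation)
  finally show ?thesis
    using assms(2) by simp
qed

lemma longest_segment_length_ge:
  assumes "bounded S" and "closed_segment a b \<subseteq> S"
  shows "dist a b \<le> longest_segment_length S"
  unfolding longest_segment_length_def
proof (rule cSup_upper)
  show "dist a b \<in> {dist a b |a b. closed_segment a b \<subseteq> S}"
    using assms(2) by blast
  show "bdd_above {dist a b |a b. closed_segment a b \<subseteq> S}"
    using assms(1) by (auto intro!: bdd_aboveI[of _ "diameter S"] diameter_bounded_bound)
qed

lemma longest_segment_length_image_ge:
  fixes g :: "'a::real_vector \<Rightarrow> real^2"
  assumes "bounded (f ` T)" and "closed_segment a b \<subseteq> T"
    and "linear g" and "\<And>x. x \<in> closed_segment a b \<Longrightarrow> f x = c + g x"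
  shows "norm (g (b - a)) \<le> longest_segment_length (f ` T)"
proof -
  have "closed_segment (f a) (f b) \<subseteq> f ` T"
    using affine_image_closed_segment[OF assms(3,4)] assms(2) by blast
  then have "dist (f a) (f b) \<le> longest_segment_length (f ` T)"
    using longest_segment_length_ge[OF assms(1)] by blast
  moreover have "dist (f a) (f b) = norm (g (b - a))"
    using assms(4) by (simp add: dist_norm linear_diff[OF assms(3)] norm_minus_commute)
  ultimately show ?thesis
    by simp
qed

lemma convex_halfspace_component_le: "convex {x::real^'n. x$i \<le> c}"
  using convex_halfspace_le[where a = "axis i (1::real)" and b = c] by (simp add: inner_axis')

lemma convex_halfspace_component_ge: "convex {x::real^'n. x$i \<ge> c}"
  using convex_halfspace_ge[where a = "axis i (1::real)" and b = c] by (simp add: inner_axis')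

lemma bcnf_eq_left: "p$1 \<le> 0 \<Longrightarrow> bcnf xi p = vector [1, 0] + AL xi *v p"
  by (cases xi) (auto simp: bcnf_def AL_def vec_eq_iff forall_2 matrix_vector_mult_def sum_2)

lemma bcnf_eq_right: "p$1 \<ge> 0 \<Longrightarrow> bcnf xi p = vector [1, 0] + AR xi *v p"
  by (cases xi) (auto simp: bcnf_def AR_def vec_eq_iff forall_2 matrix_vector_mult_def sum_2)

lemma bounded_bcnf_image:
  assumes "bounded T"
  shows "bounded (bcnf xi ` T)"
proof -
  have "bcnf xi ` T \<subseteq> (\<lambda>x. vector [1, 0] + x) ` (*v) (AL xi) ` T
                      \<union> (\<lambda>x. vector [1, 0] + x) ` (*v) (AR xi) ` T" (is "_ \<subseteq> ?L \<union> ?R")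
  proof
    fix y assume "y \<in> bcnf xi ` T"
    then obtain p where "p \<in> T" and "y = bcnf xi p"
      by blast
    then show "y \<in> ?L \<union> ?R"
      by (cases "p$1 \<le> 0") (auto simp: bcnf_eq_left bcnf_eq_right)
  qed
  then show ?thesis
    using assms by (meson bounded_Un bounded_linear_image bounded_subset bounded_translation
        matrix_vector_mul_bounded_linear)
qed

lemma longest_segment_length_bcnf_image_left:
  assumes "bounded T" and "closed_segment a b \<subseteq> T" and "a$1 \<le> 0" and "b$1 \<le> 0"
  shows "norm (AL xi *v (b - a)) \<le> longest_segment_length (bcnf xi ` T)"
proof (rule longest_segment_length_image_ge)
  have "closed_segment a b \<subseteq> {p. p$1 \<le> 0}"
    using assms(3,4) by (intro closed_segment_subset convex_halfspace_component_le) auto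
  then show "\<And>x. x \<in> closed_segment a b \<Longrightarrow> bcnf xi x = vector [1, 0] + AL xi *v x"
    by (auto intro: bcnf_eq_left)
qed (use assms bounded_bcnf_image in auto)

lemma longest_segment_length_bcnf_image_right:
  assumes "bounded T" and "closed_segment a b \<subseteq> T" and "a$1 \<ge> 0" and "b$1 \<ge> 0"
  shows "norm (AR xi *v (b - a)) \<le> longest_segment_length (bcnf xi ` T)"
proof (rule longest_segment_length_image_ge)
  have "closed_segment a b \<subseteq> {p. p$1 \<ge> 0}"
    using assms(3,4) by (intro closed_segment_subset convex_halfspace_component_ge) auto
  then show "\<And>x. x \<in> closed_segment a b \<Longrightarrow> bcnf xi x = vector [1, 0] + AR xi *v x"
    by (auto intro: bcnf_eq_right)
qed (use assms bounded_bcnf_image in auto)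

lemma longest_segment_length_bcnf_image_crossing:
  assumes "P$1 \<le> 0" and "0 \<le> Q$1"
  obtains t where "0 \<le> t" and "t \<le> 1"
    and "t * norm (AL xi *v (Q - P)) \<le> longest_segment_length (bcnf xi ` closed_segment P Q)"
    and "(1 - t) * norm (AR xi *v (Q - P)) \<le> longest_segment_length (bcnf xi ` closed_segment P Q)"
proof -
  obtain M where M: "M \<in> closed_segment P Q" and "M$1 = 0"
    using connected_ivt_component_cart[of "closed_segment P Q" P Q 1 0] assms by auto
  then obtain t where "0 \<le> t" and "t \<le> 1" and "M = (1 - t) *\<^sub>R P + t *\<^sub>R Q"
    by (auto simp: in_segment)
  then have "M - P = t *\<^sub>R (Q - P)" and "Q - M = (1 - t) *\<^sub>R (Q - P)"
    by (simp_all add: algebra_simps)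
  have "t * norm (AL xi *v (Q - P)) = norm (AL xi *v (M - P))"
    using \<open>M - P = _\<close> \<open>0 \<le> t\<close> by (simp add: matrix_vector_mult_scaleR)
  also have "\<dots> \<le> longest_segment_length (bcnf xi ` closed_segment P Q)"
    using M assms \<open>M$1 = 0\<close>
    by (intro longest_segment_length_bcnf_image_left[OF bounded_closed_segment])
      (auto simp: subset_closed_segment)
  finally have "t * norm (AL xi *v (Q - P)) \<le> longest_segment_length (bcnf xi ` closed_segment P Q)" .
  moreover have "(1 - t) * norm (AR xi *v (Q - P)) = norm (AR xi *v (Q - M))"
    using \<open>Q - M = _\<close> \<open>t \<le> 1\<close> by (simp add: matrix_vector_mult_scaleR)
  moreover have "\<dots> \<le> longest_segment_length (bcnf xi ` closed_segment P Q)"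
    using M assms \<open>M$1 = 0\<close>
    by (intro longest_segment_length_bcnf_image_right[OF bounded_closed_segment])
      (auto simp: subset_closed_segment)
  ultimately show ?thesis
    using that \<open>0 \<le> t\<close> \<open>t \<le> 1\<close> by simp
qed

lemma harmonic_combination_le:
  fixes c1 c2 t n s :: real
  assumes "c1 > 0" and "c2 > 0" and "t * c1 * n \<le> s" and "(1 - t) * c2 * n \<le> s"
  shows "c1 * c2 / (c1 + c2) * n \<le> s"
proof -
  have "c1 + c2 > 0"
    using assms(1,2) by simp
  have "c1 * c2 / (c1 + c2) * n
      = c2 / (c1 + c2) * (t * c1 * n) + c1 / (c1 + c2) * ((1 - t) * c2 * n)"
    using \<open>c1 + c2 > 0\<close> by (simp add: divide_simps) (simp add: algebra_simps)
  also have "\<dots> \<le> c2 / (c1 + c2) * s + c1 / (c1 + c2) * s"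
    using assms by (intro add_mono mult_left_mono) auto
  also have "\<dots> = s"
    using \<open>c1 + c2 > 0\<close> by (simp add: divide_simps) (simp add: algebra_simps)
  finally show ?thesis .
qed

lemma longest_segment_length_bcnf_image_ge_oriented:
  assumes "cL > 0" and "cR > 0"
    and "norm (AL xi *v (Q - P)) \<ge> cL * dist P Q"
    and "norm (AR xi *v (Q - P)) \<ge> cR * dist P Q"
    and "P$1 \<le> Q$1"
  shows "cL * cR / (cL + cR) * dist P Q \<le> longest_segment_length (bcnf xi ` closed_segment P Q)"
    (is "?k * ?d \<le> ?S")
proof -
  consider "Q$1 \<le> 0" | "0 \<le> P$1" | "P$1 \<le> 0" and "0 \<le> Q$1"
    by linarith
  then show ?thesis
  proof cases
    case 1
    then have "norm (AL xi *v (Q - P)) \<le> ?S"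
      using assms(5) by (intro longest_segment_length_bcnf_image_left) (auto simp: bounded_closed_segment)
    moreover have "?k \<le> cL"
      using assms(1,2) by (simp add: field_simps)
    ultimately show ?thesis
      using assms(3) by (meson mult_right_mono order_trans zero_le_dist)
  next
    case 2
    then have "norm (AR xi *v (Q - P)) \<le> ?S"
      using assms(5) by (intro longest_segment_length_bcnf_image_right) (auto simp: bounded_closed_segment)
    moreover have "?k \<le> cR"
      using assms(1,2) by (simp add: field_simps)
    ultimately show ?thesis
      using assms(4) by (meson mult_right_mono order_trans zero_le_dist)
  next
    case 3
    then obtain t where "0 \<le> t" and "t \<le> 1"
      and "t * norm (AL xi *v (Q - P)) \<le> ?S" and "(1 - t) * norm (AR xi *v (Q - P)) \<le> ?S"
      by (rule longest_segment_length_bcnf_image_crossing)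
    then have "t * cL * ?d \<le> ?S" and "(1 - t) * cR * ?d \<le> ?S"
      using assms(3,4) by (smt (verit) mult.assoc mult_left_mono)+
    then show ?thesis
      by (rule harmonic_combination_le[OF assms(1,2)])
  qed
qed

theorem lemma5p1:
  fixes xi :: "real \<times> real \<times> real \<times> real" and P v :: "real^2" and cL cR :: real
  assumes "cL > 0" and "cR > 0"
    and "norm (AL xi *v v) \<ge> cL * norm v"
    and "norm (AR xi *v v) \<ge> cR * norm v"
  shows "longest_segment_length (bcnf xi ` closed_segment P (P + v))
           \<ge> cL * cR / (cL + cR) * dist P (P + v)"
proof (cases "P$1 \<le> (P + v)$1")
  case True
  then show ?thesis
    using assms by (intro longest_segment_length_bcnf_image_ge_oriented) (simp_all add: dist_norm)
next
  case False
  have "norm (A *v (P - (P + v))) = norm (A *v v)" for A :: "real^2^2"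
    by (simp add: vec.neg)
  then have "cL * cR / (cL + cR) * dist (P + v) P
      \<le> longest_segment_length (bcnf xi ` closed_segment (P + v) P)"
    using assms False by (intro longest_segment_length_bcnf_image_ge_oriented) (simp_all add: dist_norm)
  then show ?thesis
    by (simp add: closed_segment_commute dist_commute)
qed

end
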